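(* (a) There exists an acyclic sound free-choice workflow net $N$ (with task durations) such that $\mathrm{CT}(N)<\ell^N_{\mathbb{Q}}$. (b) There exists a sound free-choice workflow net $N$ (with task durations) such that $\mathrm{CT}(N)<\ell^N_{\mathbb{Z}}$.
   Context: A workflow net $N=(P,T,F,I,O,\tau)$: a Petri net with input/output places $I,O$, $\bullet I=\emptyset=O\bullet$, every node on a path from $I$ to $O$, durations $\tau\colon P\to\mathbb{N}$; $M_I$ ($M_O$) puts one token on each place of $I$ ($O$). Acyclic: the reflexive-transitive closure of $F$ is a partial order. Free-choice: for any places $p_1,p_2$, $p_1\bullet\cap p_2\bullet=\emptyset$ or $p_1\bullet=p_2\bullet$. Sound: $M_O$ reachable from every marking reachable from $M_I$; every reachable $M$ with $\sum_{o\in O}M(o)\ge|O|$ equals $M_O$; every transition enabled at some reachable marking. $\mathrm{CT}(N)=\max\{\sum_{p:\tau(p)>0}M(p)\mid M\text{ reachable from }M_I\}$. The incidence matrix $\mathbf N$ is $|P|\times|T|$ with entry $1$ if $p\in t\bullet\setminus\bullet t$, $-1$ if $p\in\bullet t\setminus t\bullet$, $0$ otherwise; $\vec D(p)=1$ if $\tau(p)>0$ and $0$ otherwise. $\ell^N_{\mathbb{Q}}$ and $\ell^N_{\mathbb{Z}}$ are the optimal values of $\max\{\vec D\cdot\vec M\mid\vec M=\vec{M_I}+\mathbf N\vec X,\ \vec M\ge0,\ \vec X\ge0\}$ over rational, resp. integer, vectors $\vec M,\vec X$. *)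

theory Defs
  imports Complex_Main
begin

text \<open>
  Places and transitions are nodes of one type, kept apart by disjointness of the two carriers.
  Durations are only relevant on the places.
\<close>

record 'a workflow_net =
  places :: "'a set"
  transitions :: "'a set"
  flow :: "('a \<times> 'a) set"
  inputs :: "'a set"
  outputs :: "'a set"
  duration :: "'a \<Rightarrow> nat"

definition preset :: "('a, 'b) workflow_net_scheme \<Rightarrow> 'a \<Rightarrow> 'a set" where
  "preset N x = {y. (y, x) \<in> flow N}"

definition postset :: "('a, 'b) workflow_net_scheme \<Rightarrow> 'a \<Rightarrow> 'a set" where
  "postset N x = {y. (x, y) \<in> flow N}"

definition petri_net :: "('a, 'b) workflow_net_scheme \<Rightarrow> bool" where
  "petri_net N \<longleftrightarrow>
     finite (places N) \<and> finite (transitions N) \<and> places N \<inter> transitions N = {} \<and>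
     flow N \<subseteq> places N \<times> transitions N \<union> transitions N \<times> places N"

definition is_workflow_net :: "('a, 'b) workflow_net_scheme \<Rightarrow> bool" where
  "is_workflow_net N \<longleftrightarrow>
     petri_net N \<and> inputs N \<subseteq> places N \<and> outputs N \<subseteq> places N \<and>
     (\<forall>i\<in>inputs N. preset N i = {}) \<and> (\<forall>o'\<in>outputs N. postset N o' = {}) \<and>
     (\<forall>x\<in>places N \<union> transitions N.
        \<exists>i\<in>inputs N. \<exists>o'\<in>outputs N. (i, x) \<in> (flow N)\<^sup>* \<and> (x, o') \<in> (flow N)\<^sup>*)"

definition acyclic_net :: "('a, 'b) workflow_net_scheme \<Rightarrow> bool" where
  "acyclic_net N \<longleftrightarrow> partial_order_on UNIV ((flow N)\<^sup>*)"

definition free_choice :: "('a, 'b) workflow_net_scheme \<Rightarrow> bool" where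
  "free_choice N \<longleftrightarrow>
     (\<forall>p\<in>places N. \<forall>q\<in>places N.
        postset N p \<inter> postset N q = {} \<or> postset N p = postset N q)"

text \<open>
  A marking is a total function; every marking reachable from the initial one
  is zero outside the places, so equality of markings is plain function equality.
\<close>

definition initial_marking :: "('a, 'b) workflow_net_scheme \<Rightarrow> 'a \<Rightarrow> nat" where
  "initial_marking N p = (if p \<in> inputs N then 1 else 0)"

definition final_marking :: "('a, 'b) workflow_net_scheme \<Rightarrow> 'a \<Rightarrow> nat" where
  "final_marking N p = (if p \<in> outputs N then 1 else 0)"

definition enabled :: "('a, 'b) workflow_net_scheme \<Rightarrow> ('a \<Rightarrow> nat) \<Rightarrow> 'a \<Rightarrow> bool" where
  "enabled N M t \<longleftrightarrow> t \<in> transitions N \<and> (\<forall>p\<in>preset N t. M p \<ge> 1)"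

definition fire :: "('a, 'b) workflow_net_scheme \<Rightarrow> 'a \<Rightarrow> ('a \<Rightarrow> nat) \<Rightarrow> 'a \<Rightarrow> nat" where
  "fire N t M p =
     M p - (if p \<in> preset N t then 1 else 0) + (if p \<in> postset N t then 1 else 0)"

inductive reachable :: "('a, 'b) workflow_net_scheme \<Rightarrow> ('a \<Rightarrow> nat) \<Rightarrow> ('a \<Rightarrow> nat) \<Rightarrow> bool"
  for N where
  refl: "reachable N M M"
| step: "reachable N M M' \<Longrightarrow> enabled N M' t \<Longrightarrow> reachable N M (fire N t M')"

definition sound :: "('a, 'b) workflow_net_scheme \<Rightarrow> bool" where
  "sound N \<longleftrightarrow>
     (\<forall>M. reachable N (initial_marking N) M \<longrightarrow> reachable N M (final_marking N)) \<and>
     (\<forall>M. reachable N (initial_marking N) M \<longrightarrow> (\<Sum>p\<in>outputs N. M p) \<ge> card (outputs N) \<longrightarrow>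
        M = final_marking N) \<and>
     (\<forall>t\<in>transitions N. \<exists>M. reachable N (initial_marking N) M \<and> enabled N M t)"

text \<open>
  Maxima are rendered as relations, so that asserting one includes that the maximum exists.
\<close>

definition is_maximum :: "'v::linorder set \<Rightarrow> 'v \<Rightarrow> bool" where
  "is_maximum S m \<longleftrightarrow> m \<in> S \<and> (\<forall>x\<in>S. x \<le> m)"

definition is_concurrency_threshold :: "('a, 'b) workflow_net_scheme \<Rightarrow> nat \<Rightarrow> bool" where
  "is_concurrency_threshold N c \<longleftrightarrow>
     is_maximum {(\<Sum>p | p \<in> places N \<and> duration N p > 0. M p) | M.
       reachable N (initial_marking N) M} c"

definition incidence :: "('a, 'b) workflow_net_scheme \<Rightarrow> 'a \<Rightarrow> 'a \<Rightarrow> 'v::linordered_idom" where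
  "incidence N p t =
     (if p \<in> postset N t - preset N t then 1
      else if p \<in> preset N t - postset N t then - 1 else 0)"

definition duration_indicator :: "('a, 'b) workflow_net_scheme \<Rightarrow> 'a \<Rightarrow> 'v::linordered_idom" where
  "duration_indicator N p = (if duration N p > 0 then 1 else 0)"

text \<open>
  The vectors of the optimisation problem are functions of which only
  the values on the places (for M) and on the transitions (for X) matter.
\<close>

definition feasible ::
    "('a, 'b) workflow_net_scheme \<Rightarrow> ('a \<Rightarrow> 'v::linordered_idom) \<Rightarrow> ('a \<Rightarrow> 'v) \<Rightarrow> bool" where
  "feasible N M X \<longleftrightarrow>
     (\<forall>p\<in>places N. M p = of_nat (initial_marking N p) + (\<Sum>t\<in>transitions N. incidence N p t * X t)) \<and>
     (\<forall>p\<in>places N. M p \<ge> 0) \<and> (\<forall>t\<in>transitions N. X t \<ge> 0)"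

definition is_optimal_value :: "('a, 'b) workflow_net_scheme \<Rightarrow> 'v::linordered_idom \<Rightarrow> bool" where
  "is_optimal_value N l \<longleftrightarrow>
     is_maximum {(\<Sum>p\<in>places N. duration_indicator N p * M p) | M X. feasible N M X} l"

definition is_ell_Q :: "('a, 'b) workflow_net_scheme \<Rightarrow> rat \<Rightarrow> bool" where
  "is_ell_Q N l \<longleftrightarrow> is_optimal_value N l"

definition is_ell_Z :: "('a, 'b) workflow_net_scheme \<Rightarrow> int \<Rightarrow> bool" where
  "is_ell_Z N l \<longleftrightarrow> is_optimal_value N l"

end

theory Submission
  imports Defs
begin

text \<open>
  A choice produces either \<open>{a, b'}\<close> or \<open>{a', b}\<close>, where \<open>a'\<close> and \<open>b'\<close> still have to be turned into
  \<open>a\<close> and \<open>b\<close> before \<open>{a, b}\<close> is joined. No run marks \<open>a'\<close> and \<open>b'\<close> together, but the state equation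
  may join the \<open>a\<close> of one alternative with the \<open>b\<close> of the other and keep \<open>a'\<close> and \<open>b'\<close>.
  Over the rationals it suffices to take each alternative with weight one half; over the integers,
  a transition that leads from \<open>{a, b}\<close> back to the choice pays for taking both alternatives.
\<close>

section \<open>One-safe markings as sets of places\<close>

definition mark :: "'a set \<Rightarrow> 'a \<Rightarrow> nat" where
  "mark S p = of_bool (p \<in> S)"

text \<open>The disjointness condition says that no token lands on a place that is still marked, so
  the successor marking is again given by a set.\<close>

definition firing :: "('a, 'b) workflow_net_scheme \<Rightarrow> 'a \<Rightarrow> 'a set \<Rightarrow> 'a set \<Rightarrow> bool" where
  "firing N t S S' \<longleftrightarrow>
     t \<in> transitions N \<and> preset N t \<subseteq> S \<and> postset N t \<inter> (S - preset N t) = {} \<and>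
     S' = S - preset N t \<union> postset N t"

lemma initial_marking_eq_mark: "initial_marking N = mark (inputs N)"
  by (auto simp: initial_marking_def mark_def)

lemma final_marking_eq_mark: "final_marking N = mark (outputs N)"
  by (auto simp: final_marking_def mark_def)

lemma enabled_mark_iff: "enabled N (mark S) t \<longleftrightarrow> t \<in> transitions N \<and> preset N t \<subseteq> S"
  by (auto simp: enabled_def mark_def of_bool_def split: if_splits)

lemma fire_mark: "firing N t S S' \<Longrightarrow> fire N t (mark S) = mark S'"
  by (rule ext) (auto simp: firing_def fire_def mark_def)

text \<open>\<open>step\<close> appends firings at the end, so the induction runs over the later
  segment, which is therefore the first premise.\<close>

lemma reachable_trans: "reachable N L K \<Longrightarrow> reachable N M L \<Longrightarrow> reachable N M K"
  by (induction rule: reachable.induct) (auto intro: reachable.step)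

text \<open>Puts a firing in front of a run, so that runs can be built backwards from their
  target.\<close>

lemma firing_reachable:
  assumes "firing N t S S'" and "reachable N (mark S') M"
  shows "reachable N (mark S) M"
proof -
  have "enabled N (mark S) t"
    using assms(1) by (simp add: firing_def enabled_mark_iff)
  then have "reachable N (mark S) (mark S')"
    using fire_mark[OF assms(1)] reachable.step[OF reachable.refl, of N "mark S" t] by simp
  with assms(2) show ?thesis
    by (rule reachable_trans)
qed

text \<open>An invariant argument: a family closed under enabled firings contains all that is
  reachable. The disjointness premise also keeps every marking one-safe.\<close>

lemma reachable_mark:
  assumes "reachable N (mark S) M" and "S \<in> F"
    and "\<And>S t. S \<in> F \<Longrightarrow> t \<in> transitions N \<Longrightarrow> preset N t \<subseteq> S \<Longrightarrow>
      postset N t \<inter> (S - preset N t) = {} \<and> S - preset N t \<union> postset N t \<in> F"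
  shows "\<exists>S\<in>F. M = mark S"
  using assms(1)
proof (induction "mark S" M rule: reachable.induct)
  case refl
  then show ?case using assms(2) by blast
next
  case (step M' t)
  then obtain S' where S': "S' \<in> F" "M' = mark S'"
    by blast
  with step.hyps have t: "t \<in> transitions N" "preset N t \<subseteq> S'"
    by (simp_all add: enabled_mark_iff)
  with assms(3)[OF S'(1)]
  have "firing N t S' (S' - preset N t \<union> postset N t)" "S' - preset N t \<union> postset N t \<in> F"
    by (simp_all add: firing_def)
  with S'(2) show ?case
    by (auto dest: fire_mark)
qed

section \<open>Criteria for soundness, optimal values and thresholds\<close>

text \<open>Once the state space is known exactly, each clause of soundness is a check over its
  members.\<close>

lemma soundI:
  assumes F: "\<And>M. reachable N (initial_marking N) M \<longleftrightarrow> (\<exists>S\<in>F. M = mark S)"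
    and final: "\<And>S. S \<in> F \<Longrightarrow> reachable N (mark S) (mark (outputs N))"
    and proper: "\<And>S. S \<in> F \<Longrightarrow> card (outputs N) \<le> (\<Sum>p\<in>outputs N. mark S p) \<Longrightarrow> S = outputs N"
    and live: "\<And>t. t \<in> transitions N \<Longrightarrow> \<exists>S\<in>F. preset N t \<subseteq> S"
  shows "sound N"
  unfolding sound_def F final_marking_eq_mark
proof (intro conjI allI impI ballI)
  fix M assume "\<exists>S\<in>F. M = mark S"
  then show "reachable N M (mark (outputs N))"
    using final by auto
next
  fix M assume "\<exists>S\<in>F. M = mark S" "card (outputs N) \<le> (\<Sum>p\<in>outputs N. M p)"
  then show "M = mark (outputs N)"
    using proper by auto
next
  fix t assume t: "t \<in> transitions N"
  then obtain S where "S \<in> F" "preset N t \<subseteq> S"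
    using live by auto
  with t show "\<exists>M. (\<exists>S\<in>F. M = mark S) \<and> enabled N M t"
    by (intro exI[of _ "mark S"]) (auto simp: enabled_mark_iff)
qed

lemma optimal_valueI:
  fixes M X :: "'a \<Rightarrow> 'v::linordered_idom"
  assumes "feasible N M X" and "(\<Sum>p\<in>places N. duration_indicator N p * M p) = l"
    and "\<And>M X :: 'a \<Rightarrow> 'v. feasible N M X \<Longrightarrow> (\<Sum>p\<in>places N. duration_indicator N p * M p) \<le> l"
  shows "is_optimal_value N l"
  unfolding is_optimal_value_def is_maximum_def
proof
  show "l \<in> {(\<Sum>p\<in>places N. duration_indicator N p * M p) | M X. feasible N M X}"
    using assms(1,2) by blast
  show "\<forall>x\<in>{(\<Sum>p\<in>places N. duration_indicator N p * M p) | M X. feasible N M X}. x \<le> l"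
    using assms(3) by blast
qed

lemma concurrency_thresholdI:
  assumes F: "\<And>M. reachable N (initial_marking N) M \<longleftrightarrow> (\<exists>S\<in>F. M = mark S)"
    and "S \<in> F" "(\<Sum>p | p \<in> places N \<and> duration N p > 0. mark S p) = c"
    and "\<And>S. S \<in> F \<Longrightarrow> (\<Sum>p | p \<in> places N \<and> duration N p > 0. mark S p) \<le> c"
  shows "is_concurrency_threshold N c"
  unfolding is_concurrency_threshold_def is_maximum_def F
proof
  show "c \<in> {(\<Sum>p | p \<in> places N \<and> duration N p > 0. M p) | M. \<exists>S\<in>F. M = mark S}"
    using assms(2,3) by auto
  show "\<forall>x\<in>{(\<Sum>p | p \<in> places N \<and> duration N p > 0. M p) | M. \<exists>S\<in>F. M = mark S}. x \<le> c"
    using assms(4) by auto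
qed

section \<open>The two nets\<close>

text \<open>
  Nodes: \<open>0\<close> is the choice between the transitions \<open>1\<close> and \<open>2\<close>; the places \<open>3\<close>, \<open>4\<close>, \<open>7\<close>, \<open>8\<close> are
  \<open>a'\<close>, \<open>b'\<close>, \<open>a\<close>, \<open>b\<close>; \<open>5\<close> and \<open>6\<close> turn \<open>a'\<close> into \<open>a\<close> and \<open>b'\<close> into \<open>b\<close>; \<open>9\<close> joins \<open>a\<close> and \<open>b\<close> into
  the output \<open>10\<close>. The numbering is a topological order. The second net adds the input \<open>11\<close>, the
  transition \<open>12\<close> from it to the choice, and the transition \<open>13\<close> from \<open>{a, b}\<close> back to the choice.
\<close>

definition choice_net :: "nat workflow_net" where
  "choice_net = \<lparr>
     places = {0, 3, 4, 7, 8, 10}, transitions = {1, 2, 5, 6, 9},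
     flow = {(0,1), (0,2), (1,4), (1,7), (2,3), (2,8), (3,5), (5,7), (4,6), (6,8), (7,9), (8,9), (9,10)},
     inputs = {0}, outputs = {10}, duration = \<lambda>p. of_bool (p \<in> {3, 4, 10})\<rparr>"

definition loop_net :: "nat workflow_net" where
  "loop_net = choice_net\<lparr>
     places := insert 11 (places choice_net),
     transitions := {12, 13} \<union> transitions choice_net,
     flow := {(11,12), (12,0), (7,13), (8,13), (13,0)} \<union> flow choice_net,
     inputs := {11}\<rparr>"

text \<open>Node \<open>1\<close> has to stay a numeral, since a rewrite to \<open>Suc 0\<close>
  would keep the equations for its preset and postset from matching.\<close>

declare One_nat_def [simp del]

lemma choice_net_simps:
  "places choice_net = {0, 3, 4, 7, 8, 10}" "transitions choice_net = {1, 2, 5, 6, 9}"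
  "flow choice_net =
     {(0,1), (0,2), (1,4), (1,7), (2,3), (2,8), (3,5), (5,7), (4,6), (6,8), (7,9), (8,9), (9,10)}"
  "inputs choice_net = {0}" "outputs choice_net = {10}"
  "duration choice_net p = of_bool (p \<in> {3, 4, 10})"
  by (simp_all add: choice_net_def)

lemma loop_net_simps:
  "places loop_net = {0, 3, 4, 7, 8, 10, 11}" "transitions loop_net = {1, 2, 5, 6, 9, 12, 13}"
  "flow loop_net = {(11,12), (12,0), (7,13), (8,13), (13,0)} \<union> flow choice_net"
  "inputs loop_net = {11}" "outputs loop_net = {10}"
  "duration loop_net p = of_bool (p \<in> {3, 4, 10})"
  by (auto simp: loop_net_def choice_net_def)

lemma choice_net_preset:
  "preset choice_net 1 = {0}" "preset choice_net 2 = {0}" "preset choice_net 5 = {3}"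
  "preset choice_net 6 = {4}" "preset choice_net 9 = {7, 8}"
  "preset choice_net 0 = {}"
  by (auto simp: preset_def choice_net_simps)

lemma choice_net_postset:
  "postset choice_net 1 = {4, 7}" "postset choice_net 2 = {3, 8}" "postset choice_net 5 = {7}"
  "postset choice_net 6 = {8}" "postset choice_net 9 = {10}"
  "postset choice_net 0 = {1, 2}" "postset choice_net 3 = {5}" "postset choice_net 4 = {6}"
  "postset choice_net 7 = {9}" "postset choice_net 8 = {9}" "postset choice_net 10 = {}"
  by (auto simp: postset_def choice_net_simps)

lemma loop_net_preset:
  "preset loop_net 1 = {0}" "preset loop_net 2 = {0}" "preset loop_net 5 = {3}"
  "preset loop_net 6 = {4}" "preset loop_net 9 = {7, 8}" "preset loop_net 12 = {11}"
  "preset loop_net 13 = {7, 8}" "preset loop_net 11 = {}"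
  by (auto simp: preset_def loop_net_simps choice_net_simps)

lemma loop_net_postset:
  "postset loop_net 1 = {4, 7}" "postset loop_net 2 = {3, 8}" "postset loop_net 5 = {7}"
  "postset loop_net 6 = {8}" "postset loop_net 9 = {10}" "postset loop_net 12 = {0}"
  "postset loop_net 13 = {0}"
  "postset loop_net 0 = {1, 2}" "postset loop_net 3 = {5}" "postset loop_net 4 = {6}"
  "postset loop_net 7 = {9, 13}" "postset loop_net 8 = {9, 13}" "postset loop_net 10 = {}"
  "postset loop_net 11 = {12}"
  by (auto simp: postset_def loop_net_simps choice_net_simps)

lemmas choice_net_eval = choice_net_simps choice_net_preset choice_net_postset
lemmas loop_net_eval = loop_net_simps(1,2,4-) loop_net_preset loop_net_postset

section \<open>Paths, acyclicity and free choice\<close>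

lemma choice_net_paths:
  "x \<in> places choice_net \<union> transitions choice_net \<Longrightarrow>
     (0, x) \<in> (flow choice_net)\<^sup>* \<and> (x, 10) \<in> (flow choice_net)\<^sup>*"
proof -
  let ?R = "(flow choice_net)\<^sup>*"
  \<comment> \<open>Paths are lengthened arc by arc, forwards from \<open>0\<close> and backwards
    from \<open>10\<close>; each of the facts below adds one layer.\<close>
  have e: "(x, y) \<in> flow choice_net \<Longrightarrow> (z, x) \<in> ?R \<Longrightarrow> (z, y) \<in> ?R"
    "(x, y) \<in> flow choice_net \<Longrightarrow> (y, z) \<in> ?R \<Longrightarrow> (x, z) \<in> ?R" for x y z
    by (auto intro: rtrancl_into_rtrancl converse_rtrancl_into_rtrancl)
  have f: "(0,0) \<in> ?R" "(10,10) \<in> ?R"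
    by simp_all
  have f1: "(0,1) \<in> ?R" "(0,2) \<in> ?R" "(9,10) \<in> ?R"
    by (rule e(1)[OF _ f(1)] e(2)[OF _ f(2)]; simp add: choice_net_simps)+
  have f2: "(0,3) \<in> ?R" "(0,4) \<in> ?R" "(0,7) \<in> ?R" "(0,8) \<in> ?R" "(7,10) \<in> ?R" "(8,10) \<in> ?R"
    using e(1)[OF _ f1(1)] e(1)[OF _ f1(2)] e(2)[OF _ f1(3)] by (simp_all add: choice_net_simps)
  have f3: "(0,5) \<in> ?R" "(0,6) \<in> ?R" "(0,9) \<in> ?R" "(1,10) \<in> ?R" "(2,10) \<in> ?R"
    "(5,10) \<in> ?R" "(6,10) \<in> ?R"
    using e(1)[OF _ f2(1)] e(1)[OF _ f2(2)] e(1)[OF _ f2(3)] e(2)[OF _ f2(5)] e(2)[OF _ f2(6)]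
    by (simp_all add: choice_net_simps)
  have f4: "(0,10) \<in> ?R" "(3,10) \<in> ?R" "(4,10) \<in> ?R"
    using e(1)[OF _ f3(3)] e(2)[OF _ f3(6)] e(2)[OF _ f3(7)] by (simp_all add: choice_net_simps)
  assume "x \<in> places choice_net \<union> transitions choice_net"
  then show ?thesis
    using f f1 f2 f3 f4 by (auto simp: choice_net_simps)
qed

lemma choice_net_workflow: "is_workflow_net choice_net"
proof -
  have "petri_net choice_net"
    by (simp add: petri_net_def choice_net_simps)
  then show ?thesis
    unfolding is_workflow_net_def using choice_net_paths by (simp add: choice_net_eval)
qed

text \<open>Transition \<open>13\<close> leads into \<open>0\<close>, so \<open>0\<close> cannot be
  an input here; the fresh place \<open>11\<close> takes that role. Paths inside the first net carry
  over by monotonicity of the closure.\<close>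

lemma loop_net_workflow: "is_workflow_net loop_net"
proof -
  let ?R = "(flow loop_net)\<^sup>*"
  have "petri_net loop_net"
    by (simp add: petri_net_def loop_net_simps choice_net_simps)
  moreover have "(11, x) \<in> ?R \<and> (x, 10) \<in> ?R" if "x \<in> places loop_net \<union> transitions loop_net" for x
  proof -
    have sub: "(flow choice_net)\<^sup>* \<subseteq> ?R"
      by (rule rtrancl_mono) (auto simp: loop_net_simps(3))
    have "(11,12) \<in> flow loop_net" "(12,0) \<in> flow loop_net" "(7,13) \<in> flow loop_net"
      "(13,0) \<in> flow loop_net"
      by (simp_all add: loop_net_simps)
    then have e: "(11,12) \<in> ?R" "(12,0) \<in> ?R" "(7,13) \<in> ?R" "(13,0) \<in> ?R"
      by (simp_all add: r_into_rtrancl)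
    have c: "(0,10) \<in> ?R" "(0,7) \<in> ?R"
      using choice_net_paths[of 0] choice_net_paths[of 7]
      by (simp_all add: choice_net_simps(1) subsetD[OF sub])
    have f: "(11,0) \<in> ?R" "(12,10) \<in> ?R" "(13,10) \<in> ?R"
      by (rule rtrancl_trans[OF e(1) e(2)] rtrancl_trans[OF e(2) c(1)]
          rtrancl_trans[OF e(4) c(1)])+
    have g: "(11,10) \<in> ?R" "(11,13) \<in> ?R"
      by (rule rtrancl_trans[OF f(1) c(1)]
          rtrancl_trans[OF f(1) rtrancl_trans[OF c(2) e(3)]])+
    show ?thesis
    proof (cases "x \<in> places choice_net \<union> transitions choice_net")
      case True
      then have "(0, x) \<in> ?R" "(x, 10) \<in> ?R"
        using choice_net_paths[OF True] by (simp_all add: subsetD[OF sub])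
      then show ?thesis
        using rtrancl_trans[OF f(1)] by simp
    next
      case False
      with that e f g show ?thesis
        by (auto simp: loop_net_simps(1,2) choice_net_simps(1,2))
    qed
  qed
  ultimately show ?thesis
    unfolding is_workflow_net_def by (simp add: loop_net_eval)
qed

lemma choice_net_acyclic: "acyclic_net choice_net"
proof -
  have "acyclic (flow choice_net)"
    \<comment> \<open>Node numbers increase along every arc, while the rule asks for a decreasing
      measure; hence the sign.\<close>
    by (rule acyclicI_order[where f = "\<lambda>x. - int x"]) (auto simp: choice_net_simps)
  then show ?thesis
    unfolding acyclic_net_def partial_order_on_def preorder_on_def
    by (simp add: acyclic_impl_antisym_rtrancl trans_rtrancl refl_rtrancl)
qed

lemma choice_net_free_choice: "free_choice choice_net"
  by (simp add: free_choice_def choice_net_eval)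

text \<open>The loop consumes both \<open>7\<close> and \<open>8\<close>, exactly as the join does,
  so these two places keep equal postsets.\<close>

lemma loop_net_free_choice: "free_choice loop_net"
  by (simp add: free_choice_def loop_net_eval)

section \<open>State space and values of the acyclic net\<close>

text \<open>The full state space. No member contains both \<open>3\<close> and \<open>4\<close>,
  which is what the state equation fails to see.\<close>

definition choice_net_states :: "nat set set" where
  "choice_net_states = {{0}, {4, 7}, {3, 8}, {7, 8}, {10}}"

lemma choice_net_final:
  "S \<in> choice_net_states \<Longrightarrow> reachable choice_net (mark S) (mark {10})"
proof -
  have f1: "reachable choice_net (mark {10}) (mark {10})"
    by (rule reachable.refl)
  have f2: "reachable choice_net (mark {7, 8}) (mark {10})"
    by (rule firing_reachable[OF _ f1, where t = 9]) (auto simp: firing_def choice_net_eval)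
  have f3: "reachable choice_net (mark {4, 7}) (mark {10})"
    by (rule firing_reachable[OF _ f2, where t = 6]) (auto simp: firing_def choice_net_eval)
  have f4: "reachable choice_net (mark {3, 8}) (mark {10})"
    by (rule firing_reachable[OF _ f2, where t = 5]) (auto simp: firing_def choice_net_eval)
  have f5: "reachable choice_net (mark {0}) (mark {10})"
    by (rule firing_reachable[OF _ f3, where t = 1]) (auto simp: firing_def choice_net_eval)
  assume "S \<in> choice_net_states"
  with f1 f2 f3 f4 f5 show ?thesis
    by (auto simp: choice_net_states_def)
qed

lemma choice_net_reachable_iff:
  "reachable choice_net (initial_marking choice_net) M \<longleftrightarrow> (\<exists>S\<in>choice_net_states. M = mark S)"
proof
  assume "reachable choice_net (initial_marking choice_net) M"
  then show "\<exists>S\<in>choice_net_states. M = mark S"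
    unfolding initial_marking_eq_mark
  proof (rule reachable_mark)
    fix S t
    assume "S \<in> choice_net_states" "t \<in> transitions choice_net" "preset choice_net t \<subseteq> S"
    then show "postset choice_net t \<inter> (S - preset choice_net t) = {} \<and>
        S - preset choice_net t \<union> postset choice_net t \<in> choice_net_states"
      unfolding choice_net_states_def choice_net_simps insert_iff empty_iff
      \<comment> \<open>All pairs of a state and a transition are tried; those with the transition
        disabled contradict the preset inclusion.\<close>
      by (elim disjE) (simp_all add: choice_net_eval insert_Diff_if insert_commute)
  qed (simp add: choice_net_states_def choice_net_simps)
next
  have f1: "reachable choice_net (mark {0}) (mark {0})"
    by (rule reachable.refl)
  have f2: "reachable choice_net (mark {0}) (mark {4, 7})"
    by (rule firing_reachable[OF _ reachable.refl, where t = 1]) (auto simp: firing_def choice_net_eval)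
  have f3: "reachable choice_net (mark {0}) (mark {3, 8})"
    by (rule firing_reachable[OF _ reachable.refl, where t = 2]) (auto simp: firing_def choice_net_eval)
  have "reachable choice_net (mark {4, 7}) (mark {7, 8})"
    by (rule firing_reachable[OF _ reachable.refl, where t = 6]) (auto simp: firing_def choice_net_eval)
  from reachable_trans[OF this f2] have f4: "reachable choice_net (mark {0}) (mark {7, 8})" .
  have f5: "reachable choice_net (mark {0}) (mark {10})"
    by (rule choice_net_final) (simp add: choice_net_states_def)
  assume "\<exists>S\<in>choice_net_states. M = mark S"
  with f1 f2 f3 f4 f5 show "reachable choice_net (initial_marking choice_net) M"
    by (auto simp: initial_marking_eq_mark choice_net_simps choice_net_states_def)
qed

lemma choice_net_sound: "sound choice_net"
proof (rule soundI[OF choice_net_reachable_iff])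
  fix S assume S: "S \<in> choice_net_states"
  then show "reachable choice_net (mark S) (mark (outputs choice_net))"
    using choice_net_final by (simp add: choice_net_simps(5))
  show "S = outputs choice_net" if "card (outputs choice_net) \<le> (\<Sum>p\<in>outputs choice_net. mark S p)"
    \<comment> \<open>Every state other than \<open>{10}\<close> leaves the only output empty and so
      misses the bound 1.\<close>
    using S that by (auto simp: choice_net_states_def choice_net_simps(5) mark_def)
next
  fix t assume "t \<in> transitions choice_net"
  then show "\<exists>S\<in>choice_net_states. preset choice_net t \<subseteq> S"
    unfolding choice_net_simps insert_iff empty_iff
    by (elim disjE) (simp_all add: choice_net_states_def choice_net_eval)
qed

lemma timed_places:
  "{p \<in> places choice_net. duration choice_net p > 0} = {3, 4, 10}"
  "{p \<in> places loop_net. duration loop_net p > 0} = {3, 4, 10}"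
  by (auto simp: choice_net_simps loop_net_simps)

lemma choice_net_threshold: "is_concurrency_threshold choice_net 1"
  \<comment> \<open>No state contains two timed places, and \<open>{10}\<close> attains the value
    1.\<close>
  by (rule concurrency_thresholdI[OF choice_net_reachable_iff, of "{10}"])
    (unfold timed_places, auto simp: choice_net_states_def mark_def)

lemma choice_net_ell_Q: "is_ell_Q choice_net (3/2)"
proof -
  \<comment> \<open>Half of \<open>1\<close> supplies \<open>7\<close> and half of \<open>2\<close>
    supplies \<open>8\<close>, so \<open>9\<close> can fire by one half without \<open>5\<close> or
    \<open>6\<close>. The gain over 1 is the half token on \<open>10\<close>, which is why the
    output is timed.\<close>
  define X :: "nat \<Rightarrow> rat" where "X t = (if t \<in> {1, 2, 9} then 1/2 else 0)" for t
  define M :: "nat \<Rightarrow> rat" where "M p = (if p \<in> {3, 4, 10} then 1/2 else 0)" for p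
  have "feasible choice_net M X"
    by (simp add: feasible_def choice_net_eval M_def X_def initial_marking_def incidence_def)
  moreover have "(\<Sum>p\<in>places choice_net. duration_indicator choice_net p * M p) = 3/2"
    by (simp add: choice_net_eval M_def duration_indicator_def)
  \<comment> \<open>A dual certificate: \<open>3/2 * M 0 + M 3 + M 4 + (M 7 + M 8)/2 + M 10\<close>
    equals \<open>3/2 - (X 5 + X 6)/2\<close>.\<close>
  moreover have "(\<Sum>p\<in>places choice_net. duration_indicator choice_net p * M p) \<le> 3/2"
    if "feasible choice_net M X" for M X :: "nat \<Rightarrow> rat"
    using that
    by (simp add: feasible_def choice_net_eval initial_marking_def incidence_def
        duration_indicator_def)
  ultimately show ?thesis
    unfolding is_ell_Q_def by (rule optimal_valueI)
qed

section \<open>State space and values of the net with the loop\<close>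

text \<open>The loop only leads from \<open>{7, 8}\<close> back to \<open>{0}\<close>, so apart from
  the new initial state nothing is added.\<close>

definition loop_net_states :: "nat set set" where
  "loop_net_states = insert {11} choice_net_states"

lemma loop_net_final:
  "S \<in> loop_net_states \<Longrightarrow> reachable loop_net (mark S) (mark {10})"
proof -
  have f1: "reachable loop_net (mark {10}) (mark {10})"
    by (rule reachable.refl)
  have f2: "reachable loop_net (mark {7, 8}) (mark {10})"
    by (rule firing_reachable[OF _ f1, where t = 9]) (auto simp: firing_def loop_net_eval)
  have f3: "reachable loop_net (mark {4, 7}) (mark {10})"
    by (rule firing_reachable[OF _ f2, where t = 6]) (auto simp: firing_def loop_net_eval)
  have f4: "reachable loop_net (mark {3, 8}) (mark {10})"
    by (rule firing_reachable[OF _ f2, where t = 5]) (auto simp: firing_def loop_net_eval)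
  have f5: "reachable loop_net (mark {0}) (mark {10})"
    by (rule firing_reachable[OF _ f3, where t = 1]) (auto simp: firing_def loop_net_eval)
  have f6: "reachable loop_net (mark {11}) (mark {10})"
    by (rule firing_reachable[OF _ f5, where t = 12]) (auto simp: firing_def loop_net_eval)
  assume "S \<in> loop_net_states"
  with f1 f2 f3 f4 f5 f6 show ?thesis
    by (auto simp: loop_net_states_def choice_net_states_def)
qed

lemma loop_net_reachable_iff:
  "reachable loop_net (initial_marking loop_net) M \<longleftrightarrow> (\<exists>S\<in>loop_net_states. M = mark S)"
proof
  assume "reachable loop_net (initial_marking loop_net) M"
  then show "\<exists>S\<in>loop_net_states. M = mark S"
    unfolding initial_marking_eq_mark
  proof (rule reachable_mark)
    fix S t
    assume "S \<in> loop_net_states" "t \<in> transitions loop_net" "preset loop_net t \<subseteq> S"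
    then show "postset loop_net t \<inter> (S - preset loop_net t) = {} \<and>
        S - preset loop_net t \<union> postset loop_net t \<in> loop_net_states"
      unfolding loop_net_states_def choice_net_states_def loop_net_simps insert_iff empty_iff
      by (elim disjE) (simp_all add: loop_net_eval insert_Diff_if insert_commute)
  qed (simp add: loop_net_states_def choice_net_states_def loop_net_simps)
next
  have f1: "reachable loop_net (mark {11}) (mark {11})"
    by (rule reachable.refl)
  have f2: "reachable loop_net (mark {11}) (mark {0})"
    by (rule firing_reachable[OF _ reachable.refl, where t = 12]) (auto simp: firing_def loop_net_eval)
  have "reachable loop_net (mark {0}) (mark {4, 7})"
    by (rule firing_reachable[OF _ reachable.refl, where t = 1]) (auto simp: firing_def loop_net_eval)
  from reachable_trans[OF this f2] have f3: "reachable loop_net (mark {11}) (mark {4, 7})" .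
  have "reachable loop_net (mark {0}) (mark {3, 8})"
    by (rule firing_reachable[OF _ reachable.refl, where t = 2]) (auto simp: firing_def loop_net_eval)
  from reachable_trans[OF this f2] have f4: "reachable loop_net (mark {11}) (mark {3, 8})" .
  have "reachable loop_net (mark {4, 7}) (mark {7, 8})"
    by (rule firing_reachable[OF _ reachable.refl, where t = 6]) (auto simp: firing_def loop_net_eval)
  from reachable_trans[OF this f3] have f5: "reachable loop_net (mark {11}) (mark {7, 8})" .
  have f6: "reachable loop_net (mark {11}) (mark {10})"
    by (rule loop_net_final) (simp add: loop_net_states_def)
  assume "\<exists>S\<in>loop_net_states. M = mark S"
  with f1 f2 f3 f4 f5 f6 show "reachable loop_net (initial_marking loop_net) M"
    by (auto simp: initial_marking_eq_mark loop_net_simps loop_net_states_def choice_net_states_def)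
qed

lemma loop_net_sound: "sound loop_net"
proof (rule soundI[OF loop_net_reachable_iff])
  fix S assume S: "S \<in> loop_net_states"
  then show "reachable loop_net (mark S) (mark (outputs loop_net))"
    using loop_net_final by (simp add: loop_net_simps(5))
  show "S = outputs loop_net" if "card (outputs loop_net) \<le> (\<Sum>p\<in>outputs loop_net. mark S p)"
    using S that by (auto simp: loop_net_states_def choice_net_states_def loop_net_simps(5) mark_def)
next
  fix t assume "t \<in> transitions loop_net"
  then show "\<exists>S\<in>loop_net_states. preset loop_net t \<subseteq> S"
    unfolding loop_net_simps insert_iff empty_iff
    by (elim disjE) (simp_all add: loop_net_states_def choice_net_states_def loop_net_eval)
qed

lemma loop_net_threshold: "is_concurrency_threshold loop_net 1"
  by (rule concurrency_thresholdI[OF loop_net_reachable_iff, of "{10}"])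
    (unfold timed_places, auto simp: loop_net_states_def choice_net_states_def mark_def)

lemma loop_net_ell_Z: "is_ell_Z loop_net 2"
proof -
  \<comment> \<open>Each of \<open>12\<close>, \<open>1\<close>, \<open>2\<close>, \<open>13\<close>
    is counted once: \<open>13\<close> returns the token needed for the second alternative, using
    \<open>7\<close> from \<open>1\<close> and \<open>8\<close> from \<open>2\<close>. No firing
    order realises this, since after \<open>12\<close> and one alternative the loop is still
    disabled.\<close>
  define X :: "nat \<Rightarrow> int" where "X t = of_bool (t \<in> {1, 2, 12, 13})" for t
  define M :: "nat \<Rightarrow> int" where "M p = of_bool (p \<in> {3, 4})" for p
  have "feasible loop_net M X"
    by (simp add: feasible_def loop_net_eval M_def X_def initial_marking_def incidence_def)
  moreover have "(\<Sum>p\<in>places loop_net. duration_indicator loop_net p * M p) = 2"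
    by (simp add: loop_net_eval M_def duration_indicator_def)
  \<comment> \<open>The place invariant
    \<open>2 * M 11 + 2 * M 0 + M 3 + M 4 + M 7 + M 8 + 2 * M 10 = 2\<close> bounds the
    objective.\<close>
  moreover have "(\<Sum>p\<in>places loop_net. duration_indicator loop_net p * M p) \<le> 2"
    if "feasible loop_net M X" for M X :: "nat \<Rightarrow> int"
    using that
    by (simp add: feasible_def loop_net_eval initial_marking_def incidence_def
        duration_indicator_def)
  ultimately show ?thesis
    unfolding is_ell_Z_def by (rule optimal_valueI)
qed

theorem theorem4:
  "(\<exists>N :: nat workflow_net.
      is_workflow_net N \<and> acyclic_net N \<and> sound N \<and> free_choice N \<and>
      (\<exists>c l. is_concurrency_threshold N c \<and> is_ell_Q N l \<and> rat_of_nat c < l)) \<and>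
   (\<exists>N :: nat workflow_net.
      is_workflow_net N \<and> sound N \<and> free_choice N \<and>
      (\<exists>c l. is_concurrency_threshold N c \<and> is_ell_Z N l \<and> int c < l))"
proof
  have "rat_of_nat 1 < 3/2"
    by simp
  with choice_net_workflow choice_net_acyclic choice_net_sound choice_net_free_choice
    choice_net_threshold choice_net_ell_Q
  show "\<exists>N :: nat workflow_net.
      is_workflow_net N \<and> acyclic_net N \<and> sound N \<and> free_choice N \<and>
      (\<exists>c l. is_concurrency_threshold N c \<and> is_ell_Q N l \<and> rat_of_nat c < l)"
    by blast
  have "int 1 < 2"
    by simp
  with loop_net_workflow loop_net_sound loop_net_free_choice loop_net_threshold loop_net_ell_Z
  show "\<exists>N :: nat workflow_net.
      is_workflow_net N \<and> sound N \<and> free_choice N \<and>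
      (\<exists>c l. is_concurrency_threshold N c \<and> is_ell_Z N l \<and> int c < l)"
    by blast
qed

end
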